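(* Let $q\ge2$, $n\ge1$ and $t\ge3$ be integers. Then \[ m_q(n,t)\le \binom{n}{\left\lceil \frac{n-t+1}{\binom{t}{2}}\right\rceil}+t. \]
   Context: Let $Q=\{0,1,\dots,q-1\}$. For a nonempty set $X=\{\mathbf c^1,\dots,\mathbf c^s\}\subseteq Q^n$, a position $i\in[n]$ is undetectable for $X$ if $c^1_i=\dots=c^s_i$; let $U(X)$ be the set of undetectable positions and $\mathrm{wdesc}(X)=\{\mathbf y\in Q^n: y_i=c^1_i \text{ for all } i\in U(X)\}$. For $t\ge2$, a code $\mathcal C\subseteq Q^n$ is a wide-sense $t$-frameproof code if $\mathrm{wdesc}(X)\cap\mathcal C=X$ for every nonempty $X\subseteq\mathcal C$ with $|X|\le t$. $m_q(n,t)$ is the maximum size of a wide-sense $t$-frameproof code in $Q^n$. Binomial coefficients with negative lower index are $0$. *)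

theory Defs
  imports Complex_Main "HOL-Library.FuncSet"
begin

definition words :: "nat \<Rightarrow> nat \<Rightarrow> (nat \<Rightarrow> nat) set" where
  "words q n = {1..n} \<rightarrow>\<^sub>E {0..<q}"

definition undetectable :: "nat \<Rightarrow> (nat \<Rightarrow> nat) set \<Rightarrow> nat set" where
  "undetectable n X = {i \<in> {1..n}. \<forall>c\<in>X. \<forall>d\<in>X. c i = d i}"

text \<open>Used only for nonempty \<open>X\<close>, where all words of \<open>X\<close> agree on the undetectable positions.\<close>

definition wdesc :: "nat \<Rightarrow> nat \<Rightarrow> (nat \<Rightarrow> nat) set \<Rightarrow> (nat \<Rightarrow> nat) set" where
  "wdesc q n X = {y \<in> words q n. \<forall>i\<in>undetectable n X. \<forall>c\<in>X. y i = c i}"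

definition wide_frameproof :: "nat \<Rightarrow> nat \<Rightarrow> nat \<Rightarrow> (nat \<Rightarrow> nat) set \<Rightarrow> bool" where
  "wide_frameproof q n t C \<longleftrightarrow>
     C \<subseteq> words q n \<and>
     (\<forall>X. X \<subseteq> C \<and> X \<noteq> {} \<and> card X \<le> t \<longrightarrow> wdesc q n X \<inter> C = X)"

definition max_wide_frameproof :: "nat \<Rightarrow> nat \<Rightarrow> nat \<Rightarrow> nat" where
  "max_wide_frameproof q n t = Max (card ` {C. wide_frameproof q n t C})"

definition int_binomial :: "nat \<Rightarrow> int \<Rightarrow> nat" where
  "int_binomial n k = (if k < 0 then 0 else n choose nat k)"

text \<open>The maximum and the cardinalities above range over finite sets.\<close>

lemma finite_words: "finite (words q n)"
  by (simp add: words_def finite_PiE)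

lemma finite_wide_frameproof: "finite {C. wide_frameproof q n t C}"
  by (rule finite_subset[of _ "Pow (words q n)"])
     (auto simp: wide_frameproof_def finite_words)

lemma wide_frameproof_empty: "wide_frameproof q n t {}"
  by (simp add: wide_frameproof_def)

end

theory Submission
  imports Defs
begin

text \<open>
  Fix a codeword \<open>c\<^sub>0\<close>. The sets of positions in which the other codewords differ from \<open>c\<^sub>0\<close> form a
  \<open>(t - 1)\<close>-cover-free family: none of them is contained in the union of \<open>t - 1\<close> others. The bound is
  then that of Erdos, Frankl and Furedi for \<open>r\<close>-cover-free families, \<open>r = t - 1\<close>.
  Members with fewer than \<open>k\<close> elements, together with one private \<open>k\<close>-subset (contained in no other
  member) of each larger member that has one, form an antichain of sets of size at most \<open>k \<le> n/2\<close>,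
  so there are at most \<open>n choose k\<close> of them. For a remaining member \<open>A\<close>, each \<open>k\<close>-subset is absorbed
  by some other member, hence \<open>A\<close> has more than \<open>(r - i) k\<close> points outside any \<open>i\<close> other members;
  \<open>r + 1\<close> such members would cover more than \<open>n\<close> points.
\<close>

definition antichain :: "'a set set \<Rightarrow> bool" where
  "antichain S \<longleftrightarrow> (\<forall>A\<in>S. \<forall>B\<in>S. A \<subseteq> B \<longrightarrow> A = B)"

definition upper_shadow :: "'a set \<Rightarrow> nat \<Rightarrow> 'a set set \<Rightarrow> 'a set set" where
  "upper_shadow N j S = {B. B \<subseteq> N \<and> card B = Suc j \<and> (\<exists>A\<in>S. A \<subseteq> B)}"

text \<open>The condition \<open>finite G\<close> matters because \<open>card\<close> of an infinite
  set is 0.\<close>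

definition cover_free :: "nat \<Rightarrow> 'a set set \<Rightarrow> bool" where
  "cover_free r F \<longleftrightarrow> (\<forall>A\<in>F. \<forall>G. G \<subseteq> F - {A} \<and> finite G \<and> card G \<le> r \<longrightarrow> \<not> A \<subseteq> \<Union>G)"

text \<open>Vacuously true for a finite \<open>A\<close> with fewer than \<open>k\<close> elements,
  hence always paired with \<open>k \<le> card A\<close> below.\<close>

definition no_private_subset :: "nat \<Rightarrow> 'a set set \<Rightarrow> 'a set \<Rightarrow> bool" where
  "no_private_subset k F A \<longleftrightarrow> (\<forall>T. T \<subseteq> A \<and> card T = k \<longrightarrow> (\<exists>B\<in>F - {A}. T \<subseteq> B))"

section \<open>Upper shadows and antichains of small sets\<close>

lemma card_Suc_supersets:
  assumes N: "finite N" and A: "A \<subseteq> N" "card A = j"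
  shows "card {B. B \<subseteq> N \<and> card B = Suc j \<and> A \<subseteq> B} = card N - j"
proof -
  have fA: "finite A" using N A finite_subset by auto
  have "{B. B \<subseteq> N \<and> card B = Suc j \<and> A \<subseteq> B} = (\<lambda>x. insert x A) ` (N - A)" (is "?L = ?R")
  proof
    show "?L \<subseteq> ?R"
    proof
      fix B assume B: "B \<in> ?L"
      then have "card (B - A) = 1"
        using fA A by (simp add: card_Diff_subset)
      then obtain x where "B - A = {x}" by (auto simp: card_1_singleton_iff)
      then have "B = insert x A" "x \<in> N - A" using B by auto
      then show "B \<in> ?R" by auto
    qed
    show "?R \<subseteq> ?L" using A fA by (auto simp: card_insert_if)
  qed
  moreover have "inj_on (\<lambda>x. insert x A) (N - A)" by (auto simp: inj_on_def)
  ultimately show ?thesis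
    using fA A by (simp add: card_image card_Diff_subset)
qed

lemma card_subsets_Suc_le:
  assumes "finite B" "card B = Suc j" "\<forall>A\<in>S. card A = j"
  shows "card {A\<in>S. A \<subseteq> B} \<le> Suc j"
proof -
  have "card {A\<in>S. A \<subseteq> B} \<le> card {A. A \<subseteq> B \<and> card A = j}"
    using assms by (intro card_mono) auto
  also have "\<dots> = Suc j" using assms by (simp add: n_subsets)
  finally show ?thesis .
qed

text \<open>Double counting of the pairs \<open>A \<subseteq> B\<close>: each \<open>A\<close> lies
  below \<open>card N - j\<close> sets, each \<open>B\<close> above at most \<open>Suc j\<close>,
  and \<open>Suc j \<le> card N - j\<close>.\<close>

lemma card_le_card_upper_shadow:
  assumes N: "finite N" and S: "S \<subseteq> Pow N" "\<forall>A\<in>S. card A = j" and j: "2 * j < card N"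
  shows "card S \<le> card (upper_shadow N j S)"
proof -
  let ?T = "upper_shadow N j S"
  have fS: "finite S" by (rule finite_subset[OF S(1)]) (simp add: N)
  have fT: "finite ?T" unfolding upper_shadow_def by (rule finite_subset[of _ "Pow N"]) (use N in auto)
  have "(\<Sum>A\<in>S. card {B\<in>?T. A \<subseteq> B}) = (\<Sum>B\<in>?T. card {A\<in>S. A \<subseteq> B})"
    by (rule sum_multicount_gen[OF fS fT]) auto
  moreover have "(\<Sum>A\<in>S. card {B\<in>?T. A \<subseteq> B}) = (\<Sum>A\<in>S. card N - j)"
  proof (rule sum.cong)
    fix A assume A: "A \<in> S"
    then have "{B\<in>?T. A \<subseteq> B} = {B. B \<subseteq> N \<and> card B = Suc j \<and> A \<subseteq> B}"
      by (auto simp: upper_shadow_def)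
    then show "card {B\<in>?T. A \<subseteq> B} = card N - j"
      using card_Suc_supersets[OF N] A S by auto
  qed simp
  moreover have "(\<Sum>B\<in>?T. card {A\<in>S. A \<subseteq> B}) \<le> (\<Sum>B\<in>?T. Suc j)"
  proof (rule sum_mono)
    fix B assume "B \<in> ?T"
    then have "finite B" "card B = Suc j"
      using N by (auto simp: upper_shadow_def finite_subset)
    then show "card {A\<in>S. A \<subseteq> B} \<le> Suc j" using S by (intro card_subsets_Suc_le) auto
  qed
  ultimately have "card S * (card N - j) \<le> card ?T * Suc j" by simp
  moreover have "card S * Suc j \<le> card S * (card N - j)"
    using j by (intro mult_left_mono) auto
  ultimately have "card S * Suc j \<le> card ?T * Suc j" by linarith
  then show ?thesis by (simp only: mult_le_cancel2)
qed

text \<open>The lowest layer is replaced by its upper shadow until all sets have size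
  \<open>k\<close>. No step lowers the number of sets, since \<open>j < k\<close> gives
  \<open>2 * j < card N\<close>, and each keeps the antichain property.\<close>

lemma card_antichain_le_choose:
  assumes "finite N" "S \<subseteq> Pow N" "antichain S" "\<forall>A\<in>S. card A \<le> k" "2 * k \<le> card N"
  shows "card S \<le> card N choose k"
proof -
  have "card S \<le> card N choose k"
    if "S \<subseteq> Pow N" "antichain S" "\<forall>A\<in>S. j \<le> card A \<and> card A \<le> k" "j + d = k" for S j d
    using that
  proof (induction d arbitrary: S j)
    case 0
    then have "card S \<le> card {A. A \<subseteq> N \<and> card A = k}"
      using assms(1) by (intro card_mono) auto
    then show ?case using assms(1) by (simp add: n_subsets)
  next
    case (Suc d)
    define L where "L = {A\<in>S. card A = j}"
    define H where "H = {A\<in>S. card A \<noteq> j}"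
    let ?T = "upper_shadow N j L"
    have fS: "finite S" by (rule finite_subset[OF Suc.prems(1)]) (simp add: assms(1))
    have fT: "finite ?T" unfolding upper_shadow_def
      by (rule finite_subset[of _ "Pow N"]) (use assms(1) in auto)
    have anti: "A = B" if "A \<in> S" "B \<in> S" "A \<subseteq> B" for A B
      using Suc.prems(2) that by (auto simp: antichain_def)
    have not_sub: "\<not> B \<subseteq> A" if "B \<in> ?T" "A \<in> H" for A B
    proof
      assume "B \<subseteq> A"
      moreover obtain A' where "A' \<in> L" "A' \<subseteq> B" using \<open>B \<in> ?T\<close> by (auto simp: upper_shadow_def)
      ultimately have "A' = A" using anti[of A' A] \<open>A \<in> H\<close> by (auto simp: L_def H_def)
      then show False using \<open>A' \<in> L\<close> \<open>A \<in> H\<close> by (auto simp: L_def H_def)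
    qed
    \<comment> \<open>Sets of \<open>H\<close> have at least \<open>Suc j\<close> elements, so
      inclusion in a shadow set would be equality.\<close>
    have H_not_sub: "\<not> A \<subseteq> B" if "B \<in> ?T" "A \<in> H" for A B
    proof
      assume sub: "A \<subseteq> B"
      have "finite B" "card B = Suc j"
        using \<open>B \<in> ?T\<close> assms(1) by (auto simp: upper_shadow_def finite_subset)
      moreover have "card A \<ge> Suc j" using \<open>A \<in> H\<close> Suc.prems(3) by (force simp: H_def)
      ultimately have "A = B" using sub by (simp add: card_seteq)
      then show False using not_sub[OF that] by simp
    qed
    have "card L \<le> card ?T"
      using Suc.prems assms by (intro card_le_card_upper_shadow) (auto simp: L_def)
    moreover have "S = L \<union> H" "L \<inter> H = {}" by (auto simp: L_def H_def)
    moreover have "finite L" "finite H" using fS by (auto simp: L_def H_def)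
    moreover have "H \<inter> ?T = {}" using not_sub by blast
    ultimately have "card S \<le> card (H \<union> ?T)"
      using fT by (simp add: card_Un_disjoint)
    also have "\<dots> \<le> card N choose k"
    proof (rule Suc.IH[of _ "Suc j"])
      show "H \<union> ?T \<subseteq> Pow N" using Suc.prems(1) by (auto simp: H_def upper_shadow_def)
      have T: "A = B" if "A \<in> ?T" "B \<in> ?T" "A \<subseteq> B" for A B
      proof (rule card_subset_eq)
        show "finite B" using that(2) assms(1) by (auto simp: upper_shadow_def finite_subset)
      qed (use that in \<open>auto simp: upper_shadow_def\<close>)
      have H: "A = B" if "A \<in> H" "B \<in> H" "A \<subseteq> B" for A B
        using that anti by (auto simp: H_def)
      show "antichain (H \<union> ?T)"
        unfolding antichain_def by (metis T H not_sub H_not_sub Un_iff)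
      show "\<forall>A\<in>H \<union> ?T. Suc j \<le> card A \<and> card A \<le> k"
        using Suc.prems(3,4) by (force simp: H_def upper_shadow_def)
      show "Suc j + d = k" using Suc.prems(4) by simp
    qed
    finally show ?case .
  qed
  from this[of S 0 k] show ?thesis using assms by simp
qed

section \<open>Bounds on cover-free families\<close>

lemma cover_free_antichain:
  assumes "cover_free r F" "1 \<le> r"
  shows "antichain F"
  unfolding antichain_def
proof (intro ballI impI)
  fix A B assume *: "A \<in> F" "B \<in> F" "A \<subseteq> B"
  show "A = B"
  proof (rule ccontr)
    assume "A \<noteq> B"
    with * assms(1)[unfolded cover_free_def, rule_format, of A "{B}"] assms(2)
    show False by auto
  qed
qed

text \<open>Each of \<open>m\<close> rounds adds to \<open>G\<close> a member absorbing
  \<open>k\<close> points of what is left of \<open>A\<close>. By cover-freeness a point still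
  remains at the end.\<close>

lemma card_Diff_Union_no_private_subset:
  assumes cf: "cover_free r F" and A: "A \<in> F" "finite A" "k \<le> card A"
    and np: "no_private_subset k F A"
    and G: "G \<subseteq> F - {A}" "finite G" "card G + m \<le> r"
  shows "m * k < card (A - \<Union>G)"
  using G
proof (induction m arbitrary: G)
  case 0
  then have "A - \<Union>G \<noteq> {}" using cf A by (auto simp: cover_free_def)
  then show ?case using A by (simp add: card_gt_0_iff)
next
  case (Suc m)
  let ?R = "A - \<Union>G"
  have fin: "finite ?R" using A by simp
  have step: "\<exists>B. m * k < card (A - \<Union>(insert B G)) \<and> T \<subseteq> B" if T: "T \<subseteq> A" "card T = k" for T
  proof -
    obtain B where B: "B \<in> F - {A}" "T \<subseteq> B" using np T unfolding no_private_subset_def by blast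
    have "m * k < card (A - \<Union>(insert B G))"
    proof (rule Suc.IH)
      show "insert B G \<subseteq> F - {A}" using B(1) Suc.prems(1) by simp
      show "finite (insert B G)" using Suc.prems(2) by simp
      show "card (insert B G) + m \<le> r" using Suc.prems(2,3) by (simp add: card_insert_if)
    qed
    then show ?thesis using B by blast
  qed
  show ?case
  proof (cases "k \<le> card ?R")
    case True
    then obtain T where T: "T \<subseteq> ?R" "card T = k" by (meson obtain_subset_with_card_n)
    then obtain B where B: "m * k < card (A - \<Union>(insert B G))" "T \<subseteq> B"
      using step[of T] by blast
    have "card (A - \<Union>(insert B G)) \<le> card (?R - T)"
      using B fin by (intro card_mono) auto
    also have "\<dots> = card ?R - k"
      using T fin finite_subset[of T ?R] by (simp add: card_Diff_subset)
    finally show ?thesis using B(1) True by simp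
  next
    \<comment> \<open>With fewer than \<open>k\<close> points left, a \<open>k\<close>-subset of
      \<open>A\<close> containing them all is absorbed by one \<open>B\<close>. Then
      \<open>insert B G\<close> covers \<open>A\<close>, against the induction hypothesis.\<close>
    case False
    then obtain T where T: "?R \<subseteq> T" "T \<subseteq> A" "card T = k"
      using exists_subset_between[of ?R k A] A by auto
    then obtain B where B: "m * k < card (A - \<Union>(insert B G))" "T \<subseteq> B"
      using step[of T] by blast
    have "A - \<Union>(insert B G) = {}" using T B by auto
    then have False using B(1) by (metis card.empty not_less0)
    then show ?thesis ..
  qed
qed

text \<open>Members are added one at a time; the one added after \<open>i\<close> others brings more
  than \<open>(r - i) * k\<close> new points.\<close>

lemma card_Union_no_private_subset:
  assumes cf: "cover_free r F" and np: "\<forall>A\<in>H. finite A \<and> k \<le> card A \<and> no_private_subset k F A"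
    and "finite G" "G \<subseteq> H" "H \<subseteq> F" "card G \<le> Suc r"
  shows "(\<Sum>i<card G. (r - i) * k + 1) \<le> card (\<Union>G)"
  using assms(3-)
proof (induction G rule: finite_induct)
  case empty
  then show ?case by simp
next
  case (insert A G)
  have A: "A \<in> F" "finite A" "k \<le> card A" "no_private_subset k F A"
    using insert.prems np by auto
  have "(r - card G) * k < card (A - \<Union>G)"
    using insert by (intro card_Diff_Union_no_private_subset[OF cf A]) auto
  moreover have "(\<Sum>i<card G. (r - i) * k + 1) \<le> card (\<Union>G)" using insert by simp
  moreover have "card (\<Union>(insert A G)) = card (\<Union>G) + card (A - \<Union>G)"
  proof -
    have "\<Union>(insert A G) = \<Union>G \<union> (A - \<Union>G)" by auto
    moreover have "finite (\<Union>G)" using insert np by auto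
    ultimately show ?thesis using A by (simp only: card_Un_disjoint finite_Diff Diff_disjoint)
  qed
  ultimately show ?case using insert by simp
qed

lemma sum_diff_mult_Suc:
  fixes r k :: nat
  shows "(\<Sum>i<Suc r. (r - i) * k + 1) = k * (Suc r choose 2) + Suc r"
proof (induction r)
  case 0
  then show ?case by simp
next
  case (Suc r)
  have "(\<Sum>i<Suc (Suc r). (Suc r - i) * k + 1) = Suc r * k + 1 + (\<Sum>i<Suc r. (r - i) * k + 1)"
    \<comment> \<open>Splitting off the first term leaves the sum for \<open>r\<close>, as
      \<open>Suc r - Suc i = r - i\<close>.\<close>
    by (subst sum.lessThan_Suc_shift) simp
  then show ?case unfolding Suc.IH by (simp add: numeral_2_eq_2 algebra_simps)
qed

lemma card_no_private_subset_le:
  assumes cf: "cover_free r F" and N: "finite N" "F \<subseteq> Pow N"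
    and np: "\<forall>A\<in>H. k \<le> card A \<and> no_private_subset k F A" and H: "H \<subseteq> F"
    and n: "card N \<le> k * (Suc r choose 2) + r"
  shows "card H \<le> r"
proof (rule ccontr)
  assume "\<not> card H \<le> r"
  then obtain G where G: "G \<subseteq> H" "card G = Suc r" "finite G"
    using obtain_subset_with_card_n[of "Suc r" H] by auto
  have "\<forall>A\<in>H. finite A \<and> k \<le> card A \<and> no_private_subset k F A"
    using np H N by (metis PowD finite_subset subsetD)
  from card_Union_no_private_subset[OF cf this G(3,1) H]
  have "k * (Suc r choose 2) + Suc r \<le> card (\<Union>G)"
    unfolding G(2) sum_diff_mult_Suc by simp
  also have "\<dots> \<le> card N" using G H N by (intro card_mono) auto
  finally show False using n by simp
qed

lemma card_cover_free_le_choose: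
  assumes cf: "cover_free r F" and r: "1 \<le> r" and N: "finite N" "F \<subseteq> Pow N"
    and n: "card N \<le> k * (Suc r choose 2) + r" and k: "2 * k \<le> card N"
  shows "card F \<le> (card N choose k) + r"
proof -
  define H where "H = {A\<in>F. k \<le> card A \<and> no_private_subset k F A}"
  define P where "P = F - H"
  have anti: "A = B" if "A \<in> F" "B \<in> F" "A \<subseteq> B" for A B
    using cover_free_antichain[OF cf r] that by (auto simp: antichain_def)
  \<comment> \<open>The witness is a private \<open>k\<close>-subset if \<open>A\<close> is large,
    and \<open>A\<close> itself if it is small.\<close>
  have "\<exists>T. T \<subseteq> A \<and> card T \<le> k \<and> (\<forall>B\<in>F. T \<subseteq> B \<longrightarrow> B = A)"
    if "A \<in> P" for A
  proof (cases "k \<le> card A")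
    case True
    then have "\<not> no_private_subset k F A" using that by (auto simp: P_def H_def)
    then obtain T where "T \<subseteq> A" "card T = k" "\<forall>B\<in>F - {A}. \<not> T \<subseteq> B"
      by (auto simp: no_private_subset_def)
    then show ?thesis by (intro exI[of _ T]) auto
  next
    case False
    then show ?thesis using that anti by (intro exI[of _ A]) (auto simp: P_def)
  qed
  then obtain g where g: "\<And>A. A \<in> P \<Longrightarrow> g A \<subseteq> A \<and> card (g A) \<le> k \<and> (\<forall>B\<in>F. g A \<subseteq> B \<longrightarrow> B = A)"
    by metis
  \<comment> \<open>Yields both the antichain property of the witnesses and the injectivity of
    \<open>g\<close>.\<close>
  have eq: "A = B" if "A \<in> P" "B \<in> P" "g A \<subseteq> g B" for A B
  proof -
    have "g A \<subseteq> B" "B \<in> F" using g[OF that(2)] that by (auto simp: P_def)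
    then show ?thesis using g[OF that(1)] by blast
  qed
  have "card (g ` P) \<le> card N choose k"
  proof (rule card_antichain_le_choose[OF N(1) _ _ _ k])
    show "g ` P \<subseteq> Pow N" using g N by (force simp: P_def)
    show "antichain (g ` P)" unfolding antichain_def by (auto dest: eq)
    show "\<forall>A\<in>g ` P. card A \<le> k" using g by auto
  qed
  moreover have "inj_on g P" by (rule inj_onI) (use eq in auto)
  ultimately have "card P \<le> card N choose k" by (simp add: card_image)
  moreover have "card H \<le> r"
    by (rule card_no_private_subset_le[OF cf N _ _ n]) (auto simp: H_def)
  moreover have "F = P \<union> H" by (auto simp: P_def H_def)
  ultimately show ?thesis using card_Un_le[of P H] by simp
qed

text \<open>The case \<open>k = 0\<close> of the counting above: the only 0-subset is empty and lies
  in every other member, so no member has a private one once there are two members.\<close>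

lemma card_cover_free_le:
  assumes cf: "cover_free r F" and r: "1 \<le> r" and N: "finite N" "F \<subseteq> Pow N" "card N \<le> r"
  shows "card F \<le> r"
proof (rule ccontr)
  assume big: "\<not> card F \<le> r"
  have fF: "finite F" by (rule finite_subset[OF N(2)]) (simp add: N(1))
  have "no_private_subset 0 F A" if "A \<in> F" for A
  proof -
    have "card (F - {A}) \<noteq> 0" using that big r fF by (simp add: card_Diff_singleton)
    then obtain B where "B \<in> F - {A}" by (metis card.empty ex_in_conv)
    moreover have "T = {}" if "T \<subseteq> A" "card T = 0" for T
      using that \<open>A \<in> F\<close> N by (metis PowD card_0_eq finite_subset subsetD)
    ultimately show ?thesis unfolding no_private_subset_def by blast
  qed
  then have "card F \<le> r" using N by (intro card_no_private_subset_le[OF cf N(1,2), of F 0]) auto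
  with big show False ..
qed

section \<open>From frameproof codes to cover-free families\<close>

definition differ :: "nat \<Rightarrow> (nat \<Rightarrow> nat) \<Rightarrow> (nat \<Rightarrow> nat) \<Rightarrow> nat set" where
  "differ n c d = {i \<in> {1..n}. c i \<noteq> d i}"

text \<open>If the inclusion held, \<open>c\<close> would agree with \<open>c0\<close> wherever all
  of \<open>X\<close> does, so it would be a descendant of \<open>insert c0 X\<close>. The strict
  bound on \<open>card X\<close> leaves room for \<open>c0\<close>.\<close>

lemma differ_not_subset_Union:
  assumes wf: "wide_frameproof q n t C" and c: "c0 \<in> C" "c \<in> C" "c \<noteq> c0"
    and X: "X \<subseteq> C" "c \<notin> X" "finite X" "card X < t"
  shows "\<not> differ n c0 c \<subseteq> (\<Union>d\<in>X. differ n c0 d)"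
proof
  assume sub: "differ n c0 c \<subseteq> (\<Union>d\<in>X. differ n c0 d)"
  let ?Y = "insert c0 X"
  have "wdesc q n ?Y \<inter> C = ?Y"
    using wf c X unfolding wide_frameproof_def by (auto simp: card_insert_if)
  moreover have "c \<in> wdesc q n ?Y"
    unfolding wdesc_def
  proof (intro CollectI conjI ballI)
    show "c \<in> words q n" using wf c by (auto simp: wide_frameproof_def)
    fix i d assume i: "i \<in> undetectable n ?Y" and d: "d \<in> ?Y"
    then have "i \<notin> (\<Union>d\<in>X. differ n c0 d)" by (auto simp: undetectable_def differ_def)
    then have "i \<notin> differ n c0 c" using sub by blast
    then show "c i = d i" using i d by (auto simp: undetectable_def differ_def)
  qed
  ultimately show False using c X by auto
qed

lemma differ_cover_free:
  assumes wf: "wide_frameproof q n t C" and c0: "c0 \<in> C" and t: "2 \<le> t"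
  shows "cover_free (t - 1) (differ n c0 ` (C - {c0}))" and "inj_on (differ n c0) (C - {c0})"
proof -
  show "inj_on (differ n c0) (C - {c0})"
  proof (rule inj_onI, rule ccontr)
    fix c d assume "c \<in> C - {c0}" "d \<in> C - {c0}" "differ n c0 c = differ n c0 d" "c \<noteq> d"
    then show False using differ_not_subset_Union[OF wf c0, of c "{d}"] t by auto
  qed
  show "cover_free (t - 1) (differ n c0 ` (C - {c0}))"
    unfolding cover_free_def
  proof (intro ballI allI impI notI)
    fix A G
    assume "A \<in> differ n c0 ` (C - {c0})"
      and G: "G \<subseteq> differ n c0 ` (C - {c0}) - {A} \<and> finite G \<and> card G \<le> t - 1"
      and sub: "A \<subseteq> \<Union>G"
    then obtain c where c: "c \<in> C" "c \<noteq> c0" "A = differ n c0 c" by auto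
    \<comment> \<open>One codeword is chosen per member of \<open>G\<close>, so that
      \<open>card X = card G\<close>.\<close>
    have "G \<subseteq> differ n c0 ` (C - {c0})" using G by blast
    then obtain X where X: "X \<subseteq> C - {c0}" "inj_on (differ n c0) X" "G = differ n c0 ` X"
      using subset_image_inj[of G "differ n c0" "C - {c0}"] by blast
    have "finite X" "card X \<le> t - 1"
      using G X by (auto simp: finite_image_iff card_image)
    moreover have "c \<notin> X" using X G c by auto
    moreover have "X \<subseteq> C" using X by blast
    ultimately show False
      using differ_not_subset_Union[OF wf c0 c(1,2), of X] X c sub t by auto
  qed
qed

text \<open>The cover-free bounds with \<open>r = t - 1\<close> count all codewords but
  \<open>c0\<close>, which raises \<open>t - 1\<close> to \<open>t\<close>.\<close>

lemma card_wide_frameproof_le: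
  assumes wf: "wide_frameproof q n t C" and t: "3 \<le> t"
  shows "card C \<le> int_binomial n \<lceil>(real n - real t + 1) / real (t choose 2)\<rceil> + t"
proof (cases "C = {}")
  case True
  then show ?thesis by simp
next
  case False
  then obtain c0 where c0: "c0 \<in> C" by auto
  have fC: "finite C"
    using wf finite_words finite_subset unfolding wide_frameproof_def by metis
  let ?F = "differ n c0 ` (C - {c0})"
  define x where "x = (real n - real t + 1) / real (t choose 2)"
  have t2: "2 \<le> t" and r: "1 \<le> t - 1" and St: "Suc (t - 1) = t" using t by auto
  note cf = differ_cover_free[OF wf c0 t2]
  have F: "?F \<subseteq> Pow {1..n}" by (auto simp: differ_def)
  have cardC: "card C = card ?F + 1"
    using card.remove[OF fC c0] card_image[OF cf(2)] by simp
  have "3 choose 2 \<le> t choose 2" using t by (rule binomial_right_mono)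
  then have ch: "3 \<le> t choose 2" by (simp add: numeral_eq_Suc)
  show ?thesis
  proof (cases "\<lceil>x\<rceil> < 0")
    \<comment> \<open>Here \<open>n < t - 1\<close> and the binomial is 0, so the bound
      \<open>t - 1\<close> on the family is required.\<close>
    case True
    then have "x < 0" by linarith
    then have "real n - real t + 1 < 0" using ch by (simp add: x_def divide_less_0_iff)
    then have "card ?F \<le> t - 1"
      by (intro card_cover_free_le[OF cf(1) r _ F]) auto
    then show ?thesis using cardC t by simp
  next
    case False
    define k where "k = nat \<lceil>x\<rceil>"
    have kx: "x \<le> real k" "real k < x + 1" using False by (auto simp: k_def) linarith+
    have "real n - real t + 1 \<le> real k * real (t choose 2)"
      using kx(1) ch t by (simp add: x_def divide_le_eq)
    then have "real n \<le> real (k * (t choose 2) + (t - 1))" using t by (simp add: of_nat_diff)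
    then have n: "n \<le> k * (t choose 2) + (t - 1)" by (simp only: of_nat_le_iff)
    \<comment> \<open>A negative numerator forces \<open>k = 0\<close>. Otherwise
      \<open>t choose 2 \<ge> 3\<close> and \<open>k < x + 1\<close> give
      \<open>3 * k < n - t + 4 \<le> n + 1\<close>, by \<open>t \<ge> 3\<close>.\<close>
    have "2 * k \<le> n"
    proof (cases "real n - real t + 1 < 0")
      case True
      then have "x < 0" using ch by (simp add: x_def divide_less_0_iff)
      then have "k = 0" using kx by linarith
      then show ?thesis by simp
    next
      case False
      then have "x \<le> (real n - real t + 1) / 3"
        unfolding x_def using ch t by (intro divide_left_mono) auto
      then have "real (3 * k) < real (n + 1)" using kx(2) t by simp
      then have "3 * k < n + 1" by (simp only: of_nat_less_iff)
      then show ?thesis by simp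
    qed
    then have "card ?F \<le> (n choose k) + (t - 1)"
      using card_cover_free_le_choose[OF cf(1) r _ F, of k] n St by simp
    then show ?thesis
      using cardC t False by (simp add: int_binomial_def k_def x_def)
  qed
qed

theorem theorem1p8:
  fixes q n t :: nat
  assumes "q \<ge> 2" and "n \<ge> 1" and "t \<ge> 3"
  shows "max_wide_frameproof q n t \<le>
    int_binomial n \<lceil>(real n - real t + 1) / real (t choose 2)\<rceil> + t"
  unfolding max_wide_frameproof_def
proof (rule Max.boundedI)
  show "card ` {C. wide_frameproof q n t C} \<noteq> {}" using wide_frameproof_empty by blast
qed (use finite_wide_frameproof card_wide_frameproof_le[OF _ assms(3)] in auto)

end
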